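(* Let $\mathcal G$ be a second-countable ample groupoid (not necessarily Hausdorff). Then the following are equivalent: (1) the orbit space $\mathcal G^0/\mathcal G$ is $T_0$; (2) each orbit of $\mathcal G$ is a Baire space in the relative topology; (3) each orbit of $\mathcal G$ is discrete in the relative topology; (4) each orbit of $\mathcal G$ is locally closed in $\mathcal G^0$.
   Context: A topological groupoid $\mathcal G$ with arrow space $\mathcal G^1$ and object (unit) space $\mathcal G^0\subseteq\mathcal G^1$, source $s$ and range $r$, is étale if $s:\mathcal G^1\to\mathcal G^0$ is a local homeomorphism; it is ample if moreover $\mathcal G^0$ is Hausdorff with a basis of compact open sets. $\mathcal G^1$ is not assumed Hausdorff. Second-countable means $\mathcal G^1$ is second countable. Orbits are the classes of the equivalence relation on $\mathcal G^0$ given by $u\sim v$ iff there is an arrow with source $u$ and range $v$; the orbit space $\mathcal G^0/\mathcal G$ is the quotient space with the quotient topology. The relative topology on an orbit is the subspace topology from $\mathcal G^0$. A subspace is locally closed if it is open in its closure (in the relative topology). *)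

theory Defs
  imports "HOL-Analysis.Analysis"
begin

section \<open>Topological preliminaries\<close>

definition local_homeomorphism_map :: "'a topology \<Rightarrow> 'b topology \<Rightarrow> ('a \<Rightarrow> 'b) \<Rightarrow> bool" where
  "local_homeomorphism_map X Y f \<longleftrightarrow>
     f \<in> topspace X \<rightarrow> topspace Y \<and>
     (\<forall>x \<in> topspace X. \<exists>U. openin X U \<and> x \<in> U \<and> openin Y (f ` U) \<and>
        homeomorphic_map (subtopology X U) (subtopology Y (f ` U)) f)"

definition compact_open_basis :: "'a topology \<Rightarrow> bool" where
  "compact_open_basis X \<longleftrightarrow>
     (\<exists>\<B>. (\<forall>V \<in> \<B>. openin X V \<and> compactin X V) \<and>
          (\<forall>U x. openin X U \<and> x \<in> U \<longrightarrow> (\<exists>V \<in> \<B>. x \<in> V \<and> V \<subseteq> U)))"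

definition Baire_space :: "'a topology \<Rightarrow> bool" where
  "Baire_space X \<longleftrightarrow>
     (\<forall>U :: nat \<Rightarrow> 'a set.
        (\<forall>n. openin X (U n) \<and> X closure_of (U n) = topspace X) \<longrightarrow>
        X closure_of (\<Inter>n. U n) = topspace X)"

definition locally_closedin :: "'a topology \<Rightarrow> 'a set \<Rightarrow> bool" where
  "locally_closedin X S \<longleftrightarrow> openin (subtopology X (X closure_of S)) S"

text \<open>The points of the quotient of \<open>X\<close> by the equivalence relation \<open>R\<close> on its underlying set
  are the classes in \<open>topspace X // R\<close>. The union \<open>\<Union>W\<close> of a set \<open>W\<close> of classes is its preimage
  under the projection.\<close>

definition quotient_topology :: "'a topology \<Rightarrow> ('a \<times> 'a) set \<Rightarrow> 'a set topology" where
  "quotient_topology X R = topology (\<lambda>W. W \<subseteq> topspace X // R \<and> openin X (\<Union>W))"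

lemma openin_quotient_topology:
  assumes "equiv (topspace X) R"
  shows "openin (quotient_topology X R) W \<longleftrightarrow> W \<subseteq> topspace X // R \<and> openin X (\<Union>W)"
proof -
  have "istopology (\<lambda>W. W \<subseteq> topspace X // R \<and> openin X (\<Union>W))"
    unfolding istopology_def
  proof (intro conjI allI impI)
    fix S T
    assume S: "S \<subseteq> topspace X // R \<and> openin X (\<Union>S)"
      and T: "T \<subseteq> topspace X // R \<and> openin X (\<Union>T)"
    have "A = B" if "A \<in> S" "B \<in> T" "x \<in> A" "x \<in> B" for A B x
      using that S T quotient_disj[OF assms] by blast
    then have "\<Union>(S \<inter> T) = \<Union>S \<inter> \<Union>T"
      by blast
    with S T show "openin X (\<Union>(S \<inter> T))"
      by (simp add: openin_Int)
  next
    fix K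
    assume K: "\<forall>k\<in>K. k \<subseteq> topspace X // R \<and> openin X (\<Union>k)"
    have "\<Union>(\<Union>K) = (\<Union>k\<in>K. \<Union>k)"
      by blast
    moreover have "openin X (\<Union>k\<in>K. \<Union>k)"
      using K by (intro openin_Union) auto
    ultimately show "openin X (\<Union>(\<Union>K))"
      by simp
  qed blast+
  then show ?thesis
    by (simp add: quotient_topology_def topology_inverse')
qed

lemma topspace_quotient_topology:
  assumes "equiv (topspace X) R"
  shows "topspace (quotient_topology X R) = topspace X // R"
proof (rule antisym)
  show "topspace (quotient_topology X R) \<subseteq> topspace X // R"
    using openin_topspace[of "quotient_topology X R"] assms
    by (simp only: openin_quotient_topology)
  have "openin (quotient_topology X R) (topspace X // R)"
    using assms by (simp add: openin_quotient_topology Union_quotient)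
  then show "topspace X // R \<subseteq> topspace (quotient_topology X R)"
    by (rule openin_subset)
qed

lemma quotient_map_quotient_topology:
  assumes "equiv (topspace X) R"
  shows "quotient_map X (quotient_topology X R) (\<lambda>x. R `` {x})"
  unfolding quotient_map_def
proof (intro conjI allI impI)
  show "(\<lambda>x. R `` {x}) ` topspace X = topspace (quotient_topology X R)"
    using assms by (auto simp: topspace_quotient_topology quotient_def)
  fix W
  assume "W \<subseteq> topspace (quotient_topology X R)"
  then have W: "W \<subseteq> topspace X // R"
    using assms by (simp add: topspace_quotient_topology)
  have "{x \<in> topspace X. R `` {x} \<in> W} = \<Union>W"
  proof (intro set_eqI iffI)
    fix x
    assume "x \<in> {x \<in> topspace X. R `` {x} \<in> W}"
    then show "x \<in> \<Union>W"
      using equiv_class_self[OF assms] by blast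
  next
    fix x
    assume "x \<in> \<Union>W"
    then obtain A where A: "A \<in> W" "x \<in> A" by blast
    then obtain y where y: "y \<in> topspace X" "A = R `` {y}"
      using W by (auto simp: quotient_def)
    with A have "(y, x) \<in> R" by simp
    then have "A = R `` {x}"
      unfolding y(2) by (rule equiv_class_eq[OF assms])
    moreover have "x \<in> topspace X"
      using \<open>(y, x) \<in> R\<close> equiv_class_eq_iff[OF assms] by blast
    ultimately show "x \<in> {x \<in> topspace X. R `` {x} \<in> W}"
      using A by simp
  qed
  with W assms show "openin X {x \<in> topspace X. R `` {x} \<in> W} = openin (quotient_topology X R) W"
    by (simp add: openin_quotient_topology)
qed

section \<open>Groupoids\<close>

text \<open>Units are particular arrows, and \<open>mult g h\<close> is meaningful only if \<open>src g = rng h\<close>; the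
  operations are unconstrained elsewhere.\<close>

locale groupoid =
  fixes arrows units :: "'a set"
    and src rng :: "'a \<Rightarrow> 'a"
    and mult :: "'a \<Rightarrow> 'a \<Rightarrow> 'a"
    and inver :: "'a \<Rightarrow> 'a"
  assumes units_subset: "units \<subseteq> arrows"
    and src_in_units: "g \<in> arrows \<Longrightarrow> src g \<in> units"
    and rng_in_units: "g \<in> arrows \<Longrightarrow> rng g \<in> units"
    and src_unit: "u \<in> units \<Longrightarrow> src u = u"
    and rng_unit: "u \<in> units \<Longrightarrow> rng u = u"
    and mult_closed: "\<lbrakk>g \<in> arrows; h \<in> arrows; src g = rng h\<rbrakk> \<Longrightarrow> mult g h \<in> arrows"
    and src_mult: "\<lbrakk>g \<in> arrows; h \<in> arrows; src g = rng h\<rbrakk> \<Longrightarrow> src (mult g h) = src h"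
    and rng_mult: "\<lbrakk>g \<in> arrows; h \<in> arrows; src g = rng h\<rbrakk> \<Longrightarrow> rng (mult g h) = rng g"
    and mult_assoc: "\<lbrakk>g \<in> arrows; h \<in> arrows; k \<in> arrows; src g = rng h; src h = rng k\<rbrakk>
        \<Longrightarrow> mult (mult g h) k = mult g (mult h k)"
    and mult_src: "g \<in> arrows \<Longrightarrow> mult g (src g) = g"
    and rng_mult_self: "g \<in> arrows \<Longrightarrow> mult (rng g) g = g"
    and inver_closed: "g \<in> arrows \<Longrightarrow> inver g \<in> arrows"
    and src_inver: "g \<in> arrows \<Longrightarrow> src (inver g) = rng g"
    and rng_inver: "g \<in> arrows \<Longrightarrow> rng (inver g) = src g"
    and inver_mult: "g \<in> arrows \<Longrightarrow> mult (inver g) g = src g"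
    and mult_inver: "g \<in> arrows \<Longrightarrow> mult g (inver g) = rng g"

definition orbit_rel :: "'a set \<Rightarrow> 'a set \<Rightarrow> ('a \<Rightarrow> 'a) \<Rightarrow> ('a \<Rightarrow> 'a) \<Rightarrow> ('a \<times> 'a) set" where
  "orbit_rel arrows units src rng =
     {(u, v). u \<in> units \<and> v \<in> units \<and> (\<exists>g \<in> arrows. src g = u \<and> rng g = v)}"

definition orbits :: "'a set \<Rightarrow> 'a set \<Rightarrow> ('a \<Rightarrow> 'a) \<Rightarrow> ('a \<Rightarrow> 'a) \<Rightarrow> 'a set set" where
  "orbits arrows units src rng = units // orbit_rel arrows units src rng"

lemma (in groupoid) equiv_orbit_rel: "equiv units (orbit_rel arrows units src rng)"
proof (rule equivI)
  show "orbit_rel arrows units src rng \<subseteq> units \<times> units"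
    by (auto simp: orbit_rel_def)
  show "refl_on units (orbit_rel arrows units src rng)"
    using units_subset src_unit rng_unit by (auto simp: orbit_rel_def refl_on_def)
  show "sym (orbit_rel arrows units src rng)"
    unfolding sym_def orbit_rel_def using inver_closed src_inver rng_inver by blast
  show "trans (orbit_rel arrows units src rng)"
  proof (rule transI)
    fix u v w
    assume "(u, v) \<in> orbit_rel arrows units src rng" "(v, w) \<in> orbit_rel arrows units src rng"
    then obtain g h where "u \<in> units" "w \<in> units" "g \<in> arrows" "h \<in> arrows"
      "src g = u" "rng g = v" "src h = v" "rng h = w"
      by (auto simp: orbit_rel_def)
    then show "(u, w) \<in> orbit_rel arrows units src rng"
      using mult_closed[of h g] src_mult[of h g] rng_mult[of h g]
      by (auto simp: orbit_rel_def)
  qed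
qed

section \<open>Topological, etale and ample groupoids\<close>

text \<open>The arrow space is \<open>T\<close>, which need not be Hausdorff. The unit space carries the
  subspace topology.\<close>

locale topological_groupoid = groupoid "topspace T" units src rng mult inver
  for T :: "'a topology" and units src rng mult inver +
  assumes continuous_src: "continuous_map T (subtopology T units) src"
    and continuous_rng: "continuous_map T (subtopology T units) rng"
    and continuous_mult:
      "continuous_map
         (subtopology (prod_topology T T)
           {(g, h). g \<in> topspace T \<and> h \<in> topspace T \<and> src g = rng h})
         T (\<lambda>(g, h). mult g h)"
    and continuous_inver: "continuous_map T T inver"

locale etale_groupoid = topological_groupoid +
  assumes local_homeomorphism_src: "local_homeomorphism_map T (subtopology T units) src"

locale ample_groupoid = etale_groupoid +
  assumes Hausdorff_units: "Hausdorff_space (subtopology T units)"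
    and compact_open_basis_units: "compact_open_basis (subtopology T units)"

definition orbit_space ::
    "'a topology \<Rightarrow> 'a set \<Rightarrow> ('a \<Rightarrow> 'a) \<Rightarrow> ('a \<Rightarrow> 'a) \<Rightarrow> 'a set topology" where
  "orbit_space T units src rng =
     quotient_topology (subtopology T units) (orbit_rel (topspace T) units src rng)"

end

theory Submission
  imports Defs
begin

text \<open>Orbits are countable, since the fibres of a local homeomorphism on a second-countable space
  are countable, and they are homogeneous, since the groupoid acts on its units by partial
  homeomorphisms; so an orbit is discrete as soon as it has an isolated point. A countable Baire
  \<open>T\<^sub>1\<close> space has an isolated point, and by the Baire category theorem on its closure so
  does a countable set that is a \<open>G\<^sub>\<delta>\<close> in its closure. Locally closed orbits are of the latter
  kind, and so are all orbits if the orbit space is \<open>T\<^sub>0\<close>: the saturations of basic open sets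
  that contain an orbit cut it out of its closure. Conversely, if \<open>V\<close> meets the orbit of \<open>x\<close> in
  \<open>x\<close> only, then the saturation of \<open>V\<close> or that of \<open>V - {x}\<close> separates this orbit from a given
  other one.\<close>

section \<open>Isolated points, Baire spaces and locally closed sets in general topology\<close>

lemma openin_singleton_subtopology_iff:
  assumes "x \<in> S"
  shows "openin (subtopology X S) {x} \<longleftrightarrow> (\<exists>V. openin X V \<and> V \<inter> S = {x})"
  using assms by (auto simp: openin_subtopology)

text \<open>Baire category in the closure of \<open>S\<close>: if no point of \<open>S\<close> is
  isolated, deleting any single point of \<open>S\<close> from the closure leaves a dense open set.
  These sets and the traces of \<open>\<U>\<close> would be countably many dense open sets with
  empty intersection.\<close>

lemma Gdelta_in_closure_imp_isolated_point:
  assumes "locally_compact_space X" "Hausdorff_space X"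
    and S: "countable S" "S \<noteq> {}" "S \<subseteq> topspace X"
    and \<U>: "countable \<U>" "\<And>U. U \<in> \<U> \<Longrightarrow> openin X U" "S = X closure_of S \<inter> \<Inter>\<U>"
  shows "\<exists>x\<in>S. openin (subtopology X S) {x}"
proof (rule ccontr)
  assume no_isolated: "\<not> (\<exists>x\<in>S. openin (subtopology X S) {x})"
  define C where "C = X closure_of S"
  define Y where "Y = subtopology X C"
  have "S \<subseteq> C" "C \<subseteq> topspace X"
    using S by (simp_all add: C_def closure_of_subset closure_of_subset_topspace)
  then have top: "topspace Y = C"
    by (auto simp: Y_def)
  have "Y closure_of S = topspace Y"
    using \<open>S \<subseteq> C\<close> unfolding top by (simp add: Y_def C_def closure_of_subtopology Int_absorb1)
  have "closedin X C"
    by (simp add: C_def)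
  with assms(1,2) have Y: "locally_compact_space Y" "Hausdorff_space Y"
    by (simp_all add: Y_def locally_compact_space_closed_subset Hausdorff_space_subtopology)
  then have "regular_space Y"
    using locally_compact_Hausdorff_or_regular by blast
  define \<G> where "\<G> = (\<lambda>U. C \<inter> U) ` \<U> \<union> (\<lambda>x. C - {x}) ` S"
  have "openin Y G \<and> Y closure_of G = topspace Y" if "G \<in> \<G>" for G
  proof -
    consider U where "U \<in> \<U>" "G = C \<inter> U" | x where "x \<in> S" "G = C - {x}"
      using \<open>G \<in> \<G>\<close> by (auto simp: \<G>_def)
    then show ?thesis
    proof cases
      case 1
      have "openin Y G"
        using 1 \<U>(2) unfolding Y_def by (simp add: openin_subtopology_Int2)
      moreover have "S \<subseteq> G"
        using 1 \<U>(3) \<open>S \<subseteq> C\<close> by blast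
      then have "Y closure_of S \<subseteq> Y closure_of G"
        by (rule closure_of_mono)
      then have "Y closure_of G = topspace Y"
        using closure_of_subset_topspace[of Y G] \<open>Y closure_of S = topspace Y\<close> by simp
      ultimately show ?thesis ..
    next
      case 2
      then have "x \<in> topspace Y"
        using \<open>S \<subseteq> C\<close> top by blast
      then have "openin Y G"
        using 2 top closedin_Hausdorff_singleton[OF Y(2)] by (metis openin_diff openin_topspace)
      \<comment> \<open>A nonempty open \<open>W\<close> of \<open>Y\<close> that misses
        \<open>C - {x}\<close> is \<open>{x}\<close>, so \<open>x\<close> is isolated in the closure
        and all the more in \<open>S\<close>.\<close>
      moreover have "G \<inter> W \<noteq> {}" if W: "openin Y W" "W \<noteq> {}" for W
      proof
        assume "G \<inter> W = {}"
        then have "W = {x}"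
          using W 2 openin_subset[OF W(1)] top by auto
        then obtain V where "openin X V" "V \<inter> C = {x}"
          using W(1) by (auto simp: Y_def openin_subtopology)
        then have "openin X V" "V \<inter> S = {x}"
          using 2 \<open>S \<subseteq> C\<close> by auto
        then show False
          using no_isolated 2 openin_singleton_subtopology_iff by metis
      qed
      ultimately show ?thesis
        by (simp add: dense_intersects_open)
    qed
  qed
  moreover have "countable \<G>"
    using S(1) \<U>(1) by (simp add: \<G>_def)
  ultimately have "Y closure_of \<Inter>\<G> = topspace Y"
    using Y \<open>regular_space Y\<close> by (intro Baire_category) auto
  moreover have "\<Inter>\<G> = {}"
  proof -
    \<comment> \<open>As \<open>S\<close> is nonempty, some \<open>C - {x}\<close> belongs to
      \<open>\<G>\<close>. This also covers an empty \<open>\<U>\<close>, whose intersection is the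
      whole type.\<close>
    have "\<Inter>\<G> \<subseteq> C"
      using S(2) by (auto simp: \<G>_def)
    then have "\<Inter>\<G> \<subseteq> S"
      using \<U>(3) unfolding C_def[symmetric] by (auto simp: \<G>_def)
    then show ?thesis
      by (auto simp: \<G>_def)
  qed
  ultimately show False
    using top \<open>S \<subseteq> C\<close> S(2) by auto
qed

text \<open>Without isolated points, the complement of each point is open by \<open>t1_space\<close>
  and dense. Countably many such complements exhaust the space, so their intersection is empty
  rather than dense.\<close>

lemma countable_Baire_imp_isolated_point:
  assumes "t1_space X" "countable (topspace X)" "topspace X \<noteq> {}" "Baire_space X"
  shows "\<exists>x\<in>topspace X. openin X {x}"
proof (rule ccontr)
  assume no_isolated: "\<not> (\<exists>x\<in>topspace X. openin X {x})"
  \<comment> \<open>The enumeration repeats points if the space is finite; its range is the whole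
    space because the space is countable and nonempty.\<close>
  define e where "e = from_nat_into (topspace X)"
  have e: "range e = topspace X"
    using assms by (simp add: e_def range_from_nat_into)
  define U where "U n = topspace X - {e n}" for n
  have "openin X (U n) \<and> X closure_of (U n) = topspace X" for n
  proof
    have en: "e n \<in> topspace X"
      using e by auto
    then show "openin X (U n)"
      using assms(1) by (auto simp: U_def closedin_t1_singleton)
    have "U n \<inter> W \<noteq> {}" if "openin X W" "W \<noteq> {}" for W
    proof
      assume "U n \<inter> W = {}"
      then have "W = {e n}"
        using that openin_subset[OF that(1)] by (auto simp: U_def)
      then show False
        using that no_isolated en by blast
    qed
    then show "X closure_of (U n) = topspace X"
      by (simp add: dense_intersects_open)
  qed
  then have "X closure_of (\<Inter>n. U n) = topspace X"
    using assms(4) unfolding Baire_space_def by blast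
  moreover have "(\<Inter>n. U n) = {}"
    using e unfolding U_def by blast
  ultimately show False
    using assms(3) by simp
qed

text \<open>The only dense subset of a discrete space is the whole space.\<close>

lemma Baire_space_discrete_topology: "Baire_space (discrete_topology S)"
  unfolding Baire_space_def discrete_topology_closure_of by auto

lemma discrete_imp_locally_closedin:
  assumes "t1_space X" "S \<subseteq> topspace X" "subtopology X S = discrete_topology S"
  shows "locally_closedin X S"
  unfolding locally_closedin_def
proof (subst openin_subopen, intro ballI exI conjI)
  fix x
  assume x: "x \<in> S"
  then have "openin (subtopology X S) {x}"
    by (simp add: assms(3))
  then obtain V where V: "openin X V" "V \<inter> S = {x}"
    using x openin_singleton_subtopology_iff by metis
  \<comment> \<open>An open set that meets \<open>S\<close> only in \<open>x\<close> meets the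
    closure of \<open>S\<close> only in the closure of \<open>{x}\<close>, which is
    \<open>{x}\<close> by \<open>t1_space\<close>. Hence each point of \<open>S\<close> is isolated
    even in the closure.\<close>
  have "V \<inter> X closure_of S \<subseteq> X closure_of (V \<inter> S)"
    using V(1) by (rule openin_Int_closure_of_subset)
  also have "\<dots> = {x}"
    using V(2) assms x by (metis closedin_t1_singleton closure_of_closedin subsetD)
  finally have "V \<inter> X closure_of S = {x}"
    using V closure_of_subset[OF assms(2)] x by blast
  then show "openin (subtopology X (X closure_of S)) {x}"
    using V(1) by (auto simp: openin_subtopology)
qed (use assms in auto)

section \<open>Local homeomorphisms and compact open bases\<close>

lemma second_countable_imp_countable_fibre:
  assumes "second_countable X" "local_homeomorphism_map X Y f"
  shows "countable {x \<in> topspace X. f x = y}"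
proof -
  obtain \<B> where \<B>: "countable \<B>" "\<And>V. V \<in> \<B> \<Longrightarrow> openin X V"
    "\<And>U x. openin X U \<Longrightarrow> x \<in> U \<Longrightarrow> \<exists>V\<in>\<B>. x \<in> V \<and> V \<subseteq> U"
    using assms(1) unfolding second_countable_def by metis
  have "\<exists>V\<in>\<B>. x \<in> V \<and> inj_on f V" if x: "x \<in> topspace X" for x
  proof -
    obtain U where U: "openin X U" "x \<in> U"
      "homeomorphic_map (subtopology X U) (subtopology Y (f ` U)) f"
      using assms(2) x unfolding local_homeomorphism_map_def by blast
    have "topspace (subtopology X U) = U"
      using openin_subset[OF U(1)] by auto
    then have "inj_on f U"
      using homeomorphic_imp_injective_map[OF U(3)] by simp
    then show ?thesis
      using \<B>(3)[OF U(1,2)] inj_on_subset by blast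
  qed
  then obtain B where B: "\<And>x. x \<in> topspace X \<Longrightarrow> B x \<in> \<B> \<and> x \<in> B x \<and> inj_on f (B x)"
    by metis
  \<comment> \<open>If two points of the fibre are assigned the same basic set, both lie in it and
    have the same image, so injectivity of \<open>f\<close> there identifies them.\<close>
  have "inj_on B {x \<in> topspace X. f x = y}"
    by (rule inj_onI, simp, metis B inj_onD)
  moreover have "B ` {x \<in> topspace X. f x = y} \<subseteq> \<B>"
    using B by auto
  ultimately show ?thesis
    using \<B>(1) countable_subset countable_image_inj_on by metis
qed

lemma local_homeomorphism_imp_open_map:
  assumes "local_homeomorphism_map X Y f"
  shows "open_map X Y f"
  unfolding open_map_def
proof (intro allI impI)
  fix W
  assume W: "openin X W"
  show "openin Y (f ` W)"
  proof (subst openin_subopen, intro ballI)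
    fix y
    assume "y \<in> f ` W"
    then obtain x where x: "x \<in> W" "y = f x"
      by blast
    then have "x \<in> topspace X"
      using W openin_subset by blast
    then obtain U where U: "openin X U" "x \<in> U" "openin Y (f ` U)"
      "homeomorphic_map (subtopology X U) (subtopology Y (f ` U)) f"
      using assms unfolding local_homeomorphism_map_def by blast
    have "openin (subtopology X U) (U \<inter> W)"
      using W by (simp add: openin_subtopology_Int2)
    then have "openin (subtopology Y (f ` U)) (f ` (U \<inter> W))"
      using homeomorphic_imp_open_map[OF U(4)] by (simp add: open_map_def)
    then have "openin Y (f ` (U \<inter> W))"
      using U(3) openin_trans_full by blast
    then show "\<exists>T. openin Y T \<and> y \<in> T \<and> T \<subseteq> f ` W"
      using x U(2) by blast
  qed
qed

text \<open>A compact open neighbourhood serves both as the open and as the compact set of the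
  definition.\<close>

lemma compact_open_basis_imp_locally_compact_space:
  assumes "compact_open_basis X"
  shows "locally_compact_space X"
  using assms openin_topspace[of X]
  unfolding compact_open_basis_def locally_compact_space_def by (metis order_refl)

text \<open>Evaluate the product of \<open>inver (inver g)\<close>, \<open>inver g\<close> and
  \<open>g\<close> with both bracketings. The involution lets openness pass from \<open>src\<close>
  to \<open>rng\<close>.\<close>

lemma (in groupoid) inver_inver:
  assumes g: "g \<in> arrows"
  shows "inver (inver g) = g"
proof -
  let ?h = "inver g" and ?k = "inver (inver g)"
  have h: "?h \<in> arrows" "?k \<in> arrows"
    using g by (simp_all add: inver_closed)
  have "?k = mult ?k (mult ?h g)"
    using g h by (metis inver_mult mult_src src_inver rng_inver)
  also have "\<dots> = mult (mult ?k ?h) g"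
    using g h by (simp add: mult_assoc src_inver)
  also have "\<dots> = g"
    using g h by (simp add: inver_mult src_inver rng_mult_self)
  finally show ?thesis .
qed

section \<open>Saturations and orbits in the unit space of an etale groupoid\<close>

context etale_groupoid
begin

abbreviation "unit_space \<equiv> subtopology T units"

abbreviation "R \<equiv> orbit_rel (topspace T) units src rng"

lemma topspace_unit_space: "topspace unit_space = units"
  using units_subset by auto

text \<open>By symmetry of \<open>R\<close>, the saturation consists of the sources of the arrows
  that end in \<open>V\<close>. These arrows form an open set, and \<open>src\<close> is an open
  map.\<close>

lemma openin_saturation:
  assumes "openin unit_space V"
  shows "openin unit_space (R `` V)"
proof -
  have "openin T {g \<in> topspace T. rng g \<in> V}"
    using continuous_rng assms by (rule openin_continuous_map_preimage)
  then have "openin unit_space (src ` {g \<in> topspace T. rng g \<in> V})"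
    using local_homeomorphism_imp_open_map[OF local_homeomorphism_src] by (simp add: open_map_def)
  also have "src ` {g \<in> topspace T. rng g \<in> V} = R `` V"
  proof -
    have "R `` V = {u. \<exists>v\<in>V. (u, v) \<in> R}"
      using equiv_orbit_rel by (auto elim: equivE dest: symD)
    also have "\<dots> = src ` {g \<in> topspace T. rng g \<in> V}"
      using src_in_units rng_in_units unfolding orbit_rel_def by blast
    finally show ?thesis ..
  qed
  finally show ?thesis .
qed

text \<open>On arrows, \<open>rng\<close> is \<open>src\<close> after \<open>inver\<close>, and
  \<open>inver\<close> is a continuous involution, so preimages and images of \<open>W\<close> under
  it coincide.\<close>

lemma open_map_rng: "open_map T unit_space rng"
  unfolding open_map_def
proof (intro allI impI)
  fix W
  assume W: "openin T W"
  then have "W \<subseteq> topspace T"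
    by (rule openin_subset)
  have "openin T {g \<in> topspace T. inver g \<in> W}"
    using continuous_inver W by (rule openin_continuous_map_preimage)
  then have "openin unit_space (src ` {g \<in> topspace T. inver g \<in> W})"
    using local_homeomorphism_imp_open_map[OF local_homeomorphism_src] by (simp add: open_map_def)
  also have "src ` {g \<in> topspace T. inver g \<in> W} = rng ` W"
  proof (intro equalityI image_subsetI)
    fix g
    assume g: "g \<in> W"
    then have g': "g \<in> topspace T"
      using \<open>W \<subseteq> topspace T\<close> by blast
    then have "inver g \<in> {g \<in> topspace T. inver g \<in> W}"
      using g by (simp add: inver_closed inver_inver)
    then show "rng g \<in> src ` {g \<in> topspace T. inver g \<in> W}"
      using g' src_inver by (metis imageI)
  next
    fix g
    assume "g \<in> {g \<in> topspace T. inver g \<in> W}"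
    then show "src g \<in> rng ` W"
      using rng_inver by (metis (mono_tags) imageI mem_Collect_eq)
  qed
  finally show "openin unit_space (rng ` W)" .
qed

lemma orbit_eq: "S \<in> orbits (topspace T) units src rng \<Longrightarrow> x \<in> S \<Longrightarrow> S = R `` {x}"
  unfolding orbits_def using equiv_orbit_rel
  by (metis Image_singleton_iff equiv_class_eq quotientE)

lemma orbit_subset: "S \<in> orbits (topspace T) units src rng \<Longrightarrow> S \<subseteq> units"
  unfolding orbits_def using equiv_orbit_rel by (simp add: in_quotient_imp_subset)

lemma orbit_nonempty: "S \<in> orbits (topspace T) units src rng \<Longrightarrow> S \<noteq> {}"
  unfolding orbits_def using equiv_orbit_rel by (rule in_quotient_imp_non_empty)

text \<open>An arrow \<open>g\<close> from the isolated point \<open>x\<close> to another point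
  \<open>y\<close> of the orbit carries the isolation along: \<open>rng\<close> is open, and near
  \<open>g\<close> an arrow is determined by its source.\<close>

lemma isolated_point_imp_discrete_orbit:
  assumes S: "S \<in> orbits (topspace T) units src rng"
    and x: "x \<in> S" "openin (subtopology unit_space S) {x}"
  shows "subtopology unit_space S = discrete_topology S"
proof -
  obtain V where V: "openin unit_space V" "V \<inter> S = {x}"
    using x openin_singleton_subtopology_iff by metis
  have "openin (subtopology unit_space S) {y}" if y: "y \<in> S" for y
  proof -
    have "(x, y) \<in> R"
      using orbit_eq[OF S x(1)] y by blast
    then obtain g where g: "g \<in> topspace T" "src g = x" "rng g = y"
      by (auto simp: orbit_rel_def)
    obtain U where U: "openin T U" "g \<in> U"
      "homeomorphic_map (subtopology T U) (subtopology unit_space (src ` U)) src"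
      using local_homeomorphism_src g(1) unfolding local_homeomorphism_map_def by blast
    have "U \<subseteq> topspace T"
      using U(1) by (rule openin_subset)
    then have inj: "inj_on src U"
      using homeomorphic_imp_injective_map[OF U(3)] by (simp add: inf.absorb2)
    \<comment> \<open>These are the arrows near \<open>g\<close> that start in \<open>V\<close>.
      Such an arrow with range in \<open>S\<close> also starts in \<open>S\<close>, hence at
      \<open>x\<close>, the only point of \<open>V \<inter> S\<close>; injectivity of
      \<open>src\<close> on \<open>U\<close> then makes it equal to \<open>g\<close>, so it ends at
      \<open>y\<close>.\<close>
    define W where "W = U \<inter> {h \<in> topspace T. src h \<in> V}"
    have "openin T W"
      unfolding W_def using U(1) continuous_src V(1)
      by (intro openin_Int openin_continuous_map_preimage)
    then have "openin unit_space (rng ` W)"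
      using open_map_rng by (simp add: open_map_def)
    moreover have "rng ` W \<inter> S = {y}"
    proof
      show "{y} \<subseteq> rng ` W \<inter> S"
        using g U(2) V(2) y by (auto simp: W_def)
      show "rng ` W \<inter> S \<subseteq> {y}"
      proof clarify
        fix h
        assume h: "h \<in> W" "rng h \<in> S"
        then have "h \<in> topspace T" "src h \<in> V" "h \<in> U"
          by (auto simp: W_def)
        then have "(src h, rng h) \<in> R"
          using src_in_units rng_in_units by (auto simp: orbit_rel_def)
        then have "(rng h, src h) \<in> R"
          using equiv_orbit_rel by (meson equivE symD)
        then have "src h \<in> S"
          using orbit_eq[OF S h(2)] by blast
        then have "src h = src g"
          using V(2) \<open>src h \<in> V\<close> g by blast
        then show "rng h = y"
          using inj \<open>h \<in> U\<close> U(2) g(3) by (metis inj_onD)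
      qed
    qed
    ultimately show ?thesis
      using y openin_singleton_subtopology_iff by metis
  qed
  moreover have "topspace (subtopology unit_space S) = S"
    using orbit_subset[OF S] topspace_unit_space by auto
  ultimately show ?thesis
    by (metis discrete_topology_unique)
qed

text \<open>The orbit of \<open>x\<close> is the image under \<open>rng\<close> of the fibre of
  \<open>src\<close> over \<open>x\<close>, which is countable.\<close>

lemma countable_orbit:
  assumes "second_countable T" "S \<in> orbits (topspace T) units src rng"
  shows "countable S"
proof -
  obtain x where "x \<in> S"
    using orbit_nonempty[OF assms(2)] by blast
  then have "S = R `` {x}"
    by (rule orbit_eq[OF assms(2)])
  then have "S \<subseteq> rng ` {g \<in> topspace T. src g = x}"
    by (auto simp: orbit_rel_def)
  then show ?thesis
    using second_countable_imp_countable_fibre[OF assms(1) local_homeomorphism_src]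
      countable_subset countable_image by metis
qed

section \<open>The orbit space and its separation by saturations\<close>

lemma openin_orbit_space:
  "openin (orbit_space T units src rng) W \<longleftrightarrow>
     W \<subseteq> orbits (topspace T) units src rng \<and> openin unit_space (\<Union>W)"
  unfolding orbit_space_def orbits_def
  using openin_quotient_topology[of unit_space R] equiv_orbit_rel topspace_unit_space by simp

lemma topspace_orbit_space:
  "topspace (orbit_space T units src rng) = orbits (topspace T) units src rng"
  unfolding orbit_space_def orbits_def
  using topspace_quotient_topology[of unit_space R] equiv_orbit_rel topspace_unit_space by simp

lemma orbits_disjoint:
  assumes "A \<in> orbits (topspace T) units src rng" "B \<in> orbits (topspace T) units src rng"
    "x \<in> A" "x \<in> B"
  shows "A = B"
  using assms orbit_eq by metis

lemma open_saturation_in_orbit_space: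
  assumes "openin unit_space V"
  shows "openin (orbit_space T units src rng)
           {S \<in> orbits (topspace T) units src rng. S \<inter> V \<noteq> {}}"
proof -
  have "V \<subseteq> units"
    using openin_subset[OF assms] topspace_unit_space by simp
  have "\<Union>{S \<in> orbits (topspace T) units src rng. S \<inter> V \<noteq> {}} = R `` V"
  proof (intro equalityI subsetI)
    fix y
    assume "y \<in> \<Union>{S \<in> orbits (topspace T) units src rng. S \<inter> V \<noteq> {}}"
    then obtain S x where "S \<in> orbits (topspace T) units src rng" "y \<in> S" "x \<in> S" "x \<in> V"
      by blast
    then show "y \<in> R `` V"
      using orbit_eq by blast
  next
    fix y
    assume "y \<in> R `` V"
    then obtain x where x: "x \<in> V" "(x, y) \<in> R"
      by blast
    moreover from x have "x \<in> units"
      using \<open>V \<subseteq> units\<close> by blast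
    then have "R `` {x} \<in> orbits (topspace T) units src rng" "x \<in> R `` {x}"
      using equiv_class_self[OF equiv_orbit_rel] by (auto simp: orbits_def quotientI)
    ultimately show "y \<in> \<Union>{S \<in> orbits (topspace T) units src rng. S \<inter> V \<noteq> {}}"
      by blast
  qed
  then show ?thesis
    using openin_saturation[OF assms] by (simp add: openin_orbit_space)
qed

lemma discrete_orbits_imp_t0_orbit_space:
  assumes "t1_space unit_space"
    and discrete: "\<And>S. S \<in> orbits (topspace T) units src rng \<Longrightarrow>
      subtopology unit_space S = discrete_topology S"
  shows "t0_space (orbit_space T units src rng)"
  unfolding t0_space_def topspace_orbit_space
proof (intro ballI impI)
  fix A B
  assume A: "A \<in> orbits (topspace T) units src rng" and B: "B \<in> orbits (topspace T) units src rng"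
    and "A \<noteq> B"
  define sat where "sat V = {S \<in> orbits (topspace T) units src rng. S \<inter> V \<noteq> {}}" for V
  obtain x where x: "x \<in> A"
    using orbit_nonempty[OF A] by blast
  then have "openin (subtopology unit_space A) {x}"
    by (simp add: discrete[OF A])
  then obtain V where V: "openin unit_space V" "V \<inter> A = {x}"
    using x openin_singleton_subtopology_iff by metis
  have "x \<in> topspace unit_space"
    using V openin_subset by blast
  then have V': "openin unit_space (V - {x})"
    using V(1) assms(1) by (simp add: openin_diff closedin_t1_singleton)
  have "x \<notin> B"
    using orbits_disjoint[OF A B x] \<open>A \<noteq> B\<close> by blast
  \<comment> \<open>If \<open>B\<close> meets \<open>V\<close>, it does so away from
    \<open>x\<close>, hence in \<open>V - {x}\<close>, which \<open>A\<close> avoids. If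
    \<open>B\<close> misses \<open>V\<close>, then \<open>V\<close> itself separates, since it
    contains the point \<open>x\<close> of \<open>A\<close>.\<close>
  show "\<exists>U. openin (orbit_space T units src rng) U \<and> (A \<notin> U) = (B \<in> U)"
  proof (cases "B \<in> sat V")
    case True
    then have "B \<in> sat (V - {x})" "A \<notin> sat (V - {x})"
      using V(2) \<open>x \<notin> B\<close> by (auto simp: sat_def)
    then show ?thesis
      using open_saturation_in_orbit_space[OF V'] sat_def by metis
  next
    case False
    moreover have "A \<in> sat V"
      using A V(2) by (auto simp: sat_def)
    ultimately show ?thesis
      using open_saturation_in_orbit_space[OF V(1)] sat_def by metis
  qed
qed

lemma t0_orbit_space_imp_Gdelta_orbit:
  assumes "second_countable T" "t0_space (orbit_space T units src rng)"
    and S: "S \<in> orbits (topspace T) units src rng"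
  obtains \<U> where "countable \<U>" "\<And>U. U \<in> \<U> \<Longrightarrow> openin unit_space U"
    "S = unit_space closure_of S \<inter> \<Inter>\<U>"
proof -
  have "second_countable unit_space"
    using assms(1) by (rule second_countable_subtopology)
  then obtain \<B> where \<B>: "countable \<B>" "\<And>V. V \<in> \<B> \<Longrightarrow> openin unit_space V"
    "\<And>U x. openin unit_space U \<Longrightarrow> x \<in> U \<Longrightarrow> \<exists>V\<in>\<B>. x \<in> V \<and> V \<subseteq> U"
    unfolding second_countable_def by metis
  \<comment> \<open>The saturations of basic open sets form a countable family; those containing
    \<open>S\<close> have to exclude every point of the closure of \<open>S\<close> that lies
    outside \<open>S\<close>.\<close>
  define \<U> where "\<U> = {U \<in> (``) R ` \<B>. S \<subseteq> U}"
  have "S \<subseteq> unit_space closure_of S"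
    using orbit_subset[OF S] topspace_unit_space by (simp add: closure_of_subset)
  moreover have "y \<in> S" if y: "y \<in> unit_space closure_of S" "y \<in> \<Inter>\<U>" for y
  proof (rule ccontr)
    assume "y \<notin> S"
    define A where "A = R `` {y}"
    have "y \<in> units"
      using y(1) topspace_unit_space by (metis in_closure_of)
    then have A: "A \<in> orbits (topspace T) units src rng" "y \<in> A"
      using equiv_class_self[OF equiv_orbit_rel] by (auto simp: A_def orbits_def quotientI)
    then have "A \<noteq> S"
      using \<open>y \<notin> S\<close> by blast
    then obtain W where W: "openin (orbit_space T units src rng) W" "A \<notin> W \<longleftrightarrow> S \<in> W"
      using assms(2) A(1) S unfolding t0_space_def topspace_orbit_space by metis
    then have W': "W \<subseteq> orbits (topspace T) units src rng" "openin unit_space (\<Union>W)"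
      by (auto simp: openin_orbit_space)
    show False
    proof (cases "S \<in> W")
      \<comment> \<open>Here the separating set contains \<open>S\<close> but not the orbit
        \<open>A\<close> of \<open>y\<close>. A basic \<open>V\<close> around a point of
        \<open>S\<close> inside \<open>\<Union>W\<close> has its saturation in \<open>\<U>\<close>,
        so \<open>A\<close> meets \<open>V\<close>. Since \<open>\<Union>W\<close> is a union of
        orbits, \<open>A\<close> would belong to \<open>W\<close>.\<close>
      case True
      obtain x where x: "x \<in> S"
        using orbit_nonempty[OF S] by blast
      then obtain V where V: "V \<in> \<B>" "x \<in> V" "V \<subseteq> \<Union>W"
        using \<B>(3)[OF W'(2)] True by blast
      have "S \<subseteq> R `` V"
        using orbit_eq[OF S x] V(2) by blast
      then have "R `` V \<in> \<U>"
        using V(1) by (auto simp: \<U>_def)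
      then obtain z where z: "z \<in> V" "(z, y) \<in> R"
        using y(2) by blast
      then have "(y, z) \<in> R"
        using equiv_orbit_rel by (meson equivE symD)
      then have "z \<in> A"
        by (simp add: A_def)
      moreover obtain B where "B \<in> W" "z \<in> B"
        using z(1) V(3) by blast
      ultimately have "A \<in> W"
        using orbits_disjoint A(1) W'(1) by (metis subsetD)
      then show False
        using W(2) True by blast
    next
      \<comment> \<open>Now \<open>\<Union>W\<close> is an open neighbourhood of \<open>y\<close>,
        which lies in the closure of \<open>S\<close>; so it meets \<open>S\<close>, and being a
        union of orbits it contains all of \<open>S\<close>.\<close>
      case False
      then have "y \<in> \<Union>W"
        using W(2) A(2) by blast
      then obtain z where z: "z \<in> S" "z \<in> \<Union>W"
        using y(1) W'(2) by (meson in_closure_of)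
      then obtain B where "B \<in> W" "z \<in> B"
        by blast
      then have "S \<in> W"
        using orbits_disjoint S z(1) W'(1) by (metis subsetD)
      then show False
        using False by blast
    qed
  qed
  moreover have "S \<subseteq> \<Inter>\<U>"
    by (auto simp: \<U>_def)
  ultimately have "S = unit_space closure_of S \<inter> \<Inter>\<U>"
    by blast
  moreover have "countable \<U>"
    using \<B>(1) by (simp add: \<U>_def)
  moreover have "openin unit_space U" if "U \<in> \<U>" for U
    using that \<B>(2) openin_saturation by (auto simp: \<U>_def)
  ultimately show ?thesis
    using that by blast
qed

end

section \<open>Comparison of the four conditions through discreteness of the orbits\<close>

theorem proposition5p2:
  fixes T :: "'a topology"
    and units :: "'a set"
    and src rng :: "'a \<Rightarrow> 'a"
    and mult :: "'a \<Rightarrow> 'a \<Rightarrow> 'a"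
    and inver :: "'a \<Rightarrow> 'a"
  assumes "ample_groupoid T units src rng mult inver"
    and "second_countable T"
  shows "(t0_space (orbit_space T units src rng) \<longleftrightarrow>
            (\<forall>S \<in> orbits (topspace T) units src rng.
              Baire_space (subtopology (subtopology T units) S))) \<and>
         ((\<forall>S \<in> orbits (topspace T) units src rng.
              Baire_space (subtopology (subtopology T units) S)) \<longleftrightarrow>
            (\<forall>S \<in> orbits (topspace T) units src rng.
              subtopology (subtopology T units) S = discrete_topology S)) \<and>
         ((\<forall>S \<in> orbits (topspace T) units src rng.
              subtopology (subtopology T units) S = discrete_topology S) \<longleftrightarrow>
            (\<forall>S \<in> orbits (topspace T) units src rng.
              locally_closedin (subtopology T units) S))"
proof -
  interpret ample_groupoid T units src rng mult inver
    by fact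
  define O\<^sub>G where "O\<^sub>G = orbits (topspace T) units src rng"
  note Hausdorff = Hausdorff_units
  have t1: "t1_space unit_space"
    using Hausdorff by (rule Hausdorff_imp_t1_space)
  have lc: "locally_compact_space unit_space"
    using compact_open_basis_units by (rule compact_open_basis_imp_locally_compact_space)
  have orbit: "countable S" "S \<noteq> {}" "S \<subseteq> topspace unit_space" if "S \<in> O\<^sub>G" for S
    using that countable_orbit[OF assms(2)] orbit_nonempty orbit_subset topspace_unit_space
    unfolding O\<^sub>G_def by auto
  \<comment> \<open>This is the common route to discreteness from the separation of the orbit space
    and from local closedness: one isolated point from Baire category, then homogeneity of the
    orbit.\<close>
  have Gdelta: "subtopology unit_space S = discrete_topology S"
    if "S \<in> O\<^sub>G" "countable \<U>" "\<And>U. U \<in> \<U> \<Longrightarrow> openin unit_space U"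
      "S = unit_space closure_of S \<inter> \<Inter>\<U>" for S \<U>
    using Gdelta_in_closure_imp_isolated_point[OF lc Hausdorff orbit[OF that(1)] that(2-4)]
      isolated_point_imp_discrete_orbit that(1) unfolding O\<^sub>G_def by blast
  \<comment> \<open>Each of the other three conditions is shown equivalent to
    \<open>?discrete\<close>; the stated chain of equivalences then follows propositionally.\<close>
  let ?T0 = "t0_space (orbit_space T units src rng)"
    and ?Baire = "\<forall>S\<in>O\<^sub>G. Baire_space (subtopology unit_space S)"
    and ?discrete = "\<forall>S\<in>O\<^sub>G. subtopology unit_space S = discrete_topology S"
    and ?lclosed = "\<forall>S\<in>O\<^sub>G. locally_closedin unit_space S"
  have "?T0 \<Longrightarrow> ?discrete"
    using t0_orbit_space_imp_Gdelta_orbit[OF assms(2)] Gdelta O\<^sub>G_def by metis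
  moreover have "?discrete \<Longrightarrow> ?T0"
    using discrete_orbits_imp_t0_orbit_space[OF t1] O\<^sub>G_def by blast
  moreover have "?Baire \<Longrightarrow> ?discrete"
  proof
    fix S
    assume ?Baire and S: "S \<in> O\<^sub>G"
    have "topspace (subtopology unit_space S) = S"
      using orbit[OF S] by (simp add: inf.absorb2)
    then have "\<exists>x\<in>S. openin (subtopology unit_space S) {x}"
      using countable_Baire_imp_isolated_point[of "subtopology unit_space S"] t1_space_subtopology[OF t1]
        orbit[OF S] \<open>?Baire\<close> S by metis
    then show "subtopology unit_space S = discrete_topology S"
      using isolated_point_imp_discrete_orbit S O\<^sub>G_def by blast
  qed
  moreover have "?discrete \<Longrightarrow> ?Baire"
    by (simp add: Baire_space_discrete_topology)
  moreover have "?lclosed \<Longrightarrow> ?discrete"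
  proof
    fix S
    assume ?lclosed and S: "S \<in> O\<^sub>G"
    \<comment> \<open>A locally closed orbit is cut out of its closure by a single open set, so the
      countable family is \<open>{U}\<close>.\<close>
    then obtain U where "openin unit_space U" "S = U \<inter> unit_space closure_of S"
      unfolding locally_closedin_def openin_subtopology by blast
    then show "subtopology unit_space S = discrete_topology S"
      using Gdelta[OF S, of "{U}"] by (simp add: Int_commute)
  qed
  moreover have "?discrete \<Longrightarrow> ?lclosed"
    using discrete_imp_locally_closedin[OF t1] orbit by blast
  ultimately show ?thesis
    unfolding O\<^sub>G_def by argo
qed

end
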